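(* Let $\Gamma=(G,v_0,\mathcal{L})$ be an edge-symmetric terminal game satisfying condition (CIW): infinite plays are worse than any terminal play for all players, i.e. $\mathcal{L}^i(w)<0$ for all $i\in I$ and $w\in V_T$. Then $\Gamma$ has a Nash equilibrium. Furthermore, $\Gamma$ has a terminal Nash equilibrium whenever $V_T$ is reachable from $v_0$, i.e. whenever $G$ contains a directed path from $v_0$ to some vertex of $V_T$.
   Context: **Terminal games.** $G=(V,E)$ is a finite directed graph; vertices are positions, directed edges are moves. $I=\{1,\dots,n\}$ is the set of players. $V=V_1\cup\dots\cup V_n\cup V_T$ is a given partition of $V$, where $V_i$ is the set of positions controlled by player $i$ and $V_T\ne\emptyset$ is the set of terminal positions; terminals are exactly the positions with no outgoing edge. $v_0\in V\setminus V_T$ is the initial position. $\mathcal{L}=(\mathcal{L}^i\mid i\in I)$ with $\mathcal{L}^i:V_T\to\mathbb{R}$. A (pure stationary) strategy of player $i$ is a map $\sigma_i:V_i\to V$ with $(v,\sigma_i(v))\in E$ for all $v\in V_i$. A situation is a tuple $\sigma=(\sigma_i\mid i\in I)$ of strategies. The play $P(\sigma)$ is the directed walk starting at $v_0$ that from each position $v\in V_i$ moves to $\sigma_i(v)$; it either reaches a terminal and stops (terminal play), or is infinite. The effective cost $\mathcal{L}^i(\sigma)$ of player $i$ is $\mathcal{L}^i(w)$ if $P(\sigma)$ terminates at $w\in V_T$, and $0$ if $P(\sigma)$ is infinite. All players minimize their effective cost. A situation $\sigma$ is a Nash equilibrium (NE) if $\mathcal{L}^i(\sigma)\le\mathcal{L}^i(\sigma')$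 for every player $i$ and every situation $\sigma'$ that may differ from $\sigma$ only in the strategy of player $i$; it is a terminal NE if moreover $P(\sigma)$ is a terminal play. The game is edge-symmetric if $G$ is symmetric: $(u,v)\in E$ whenever $(v,u)\in E$, except if $u\in V_T$. *)

theory Defs
  imports Complex_Main "HOL-Library.FuncSet" "Graph_Theory.Pair_Digraph"
begin

text \<open>
  A terminal game is a record whose players are \<open>{1..num_players}\<close>. The field
  \<open>controlled\<close> is meaningful only on players, and \<open>local_cost\<close> only on pairs of a player
  and a terminal position.
\<close>

record 'v terminal_game =
  digraph_of :: "'v pair_pre_digraph"
  num_players :: nat
  controlled :: "nat \<Rightarrow> 'v set"
  terminals :: "'v set"
  initial :: 'v
  local_cost :: "nat \<Rightarrow> 'v \<Rightarrow> real"

abbreviation positions :: "('v, 'm) terminal_game_scheme \<Rightarrow> 'v set" where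
  "positions \<Gamma> \<equiv> pverts (digraph_of \<Gamma>)"

abbreviation moves :: "('v, 'm) terminal_game_scheme \<Rightarrow> 'v rel" where
  "moves \<Gamma> \<equiv> parcs (digraph_of \<Gamma>)"

abbreviation players :: "('v, 'm) terminal_game_scheme \<Rightarrow> nat set" where
  "players \<Gamma> \<equiv> {1..num_players \<Gamma>}"

text \<open>Loops are allowed, and a player may control no position.\<close>

locale terminal_game =
  fixes \<Gamma> :: "('v, 'm) terminal_game_scheme" (structure)
  assumes finite_digraph: "pair_fin_digraph (digraph_of \<Gamma>)"
    and positions_eq: "positions \<Gamma> = (\<Union>i\<in>players \<Gamma>. controlled \<Gamma> i) \<union> terminals \<Gamma>"
    and controlled_disjoint: "disjoint_family_on (controlled \<Gamma>) (players \<Gamma>)"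
    and controlled_nonterminal: "\<And>i. i \<in> players \<Gamma> \<Longrightarrow> controlled \<Gamma> i \<inter> terminals \<Gamma> = {}"
    and terminals_nonempty: "terminals \<Gamma> \<noteq> {}"
    and terminals_iff:
      "\<And>v. v \<in> positions \<Gamma> \<Longrightarrow> v \<in> terminals \<Gamma> \<longleftrightarrow> (\<forall>u. (v, u) \<notin> moves \<Gamma>)"
    and initial_nonterminal: "initial \<Gamma> \<in> positions \<Gamma> - terminals \<Gamma>"

definition strategies :: "('v, 'm) terminal_game_scheme \<Rightarrow> nat \<Rightarrow> ('v \<Rightarrow> 'v) set" where
  "strategies \<Gamma> i = (\<Pi>\<^sub>E v\<in>controlled \<Gamma> i. {u. (v, u) \<in> moves \<Gamma>})"

definition situations :: "('v, 'm) terminal_game_scheme \<Rightarrow> (nat \<Rightarrow> 'v \<Rightarrow> 'v) set" where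
  "situations \<Gamma> = (\<Pi>\<^sub>E i\<in>players \<Gamma>. strategies \<Gamma> i)"

definition controller :: "('v, 'm) terminal_game_scheme \<Rightarrow> 'v \<Rightarrow> nat" where
  "controller \<Gamma> v = (THE i. i \<in> players \<Gamma> \<and> v \<in> controlled \<Gamma> i)"

text \<open>
  \<open>play \<Gamma> \<sigma> k\<close> is the position after \<open>k\<close> moves, and \<open>None\<close> once the play has stopped
  at a terminal position.
\<close>

primrec play :: "('v, 'm) terminal_game_scheme \<Rightarrow> (nat \<Rightarrow> 'v \<Rightarrow> 'v) \<Rightarrow> nat \<Rightarrow> 'v option" where
  "play \<Gamma> \<sigma> 0 = Some (initial \<Gamma>)"
| "play \<Gamma> \<sigma> (Suc k) = (case play \<Gamma> \<sigma> k of
      None \<Rightarrow> None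
    | Some v \<Rightarrow> if v \<in> terminals \<Gamma> then None else Some (\<sigma> (controller \<Gamma> v) v))"

definition terminates_at ::
    "('v, 'm) terminal_game_scheme \<Rightarrow> (nat \<Rightarrow> 'v \<Rightarrow> 'v) \<Rightarrow> 'v \<Rightarrow> bool" where
  "terminates_at \<Gamma> \<sigma> w \<longleftrightarrow> w \<in> terminals \<Gamma> \<and> (\<exists>k. play \<Gamma> \<sigma> k = Some w)"

definition terminal_play ::
    "('v, 'm) terminal_game_scheme \<Rightarrow> (nat \<Rightarrow> 'v \<Rightarrow> 'v) \<Rightarrow> bool" where
  "terminal_play \<Gamma> \<sigma> \<longleftrightarrow> (\<exists>w. terminates_at \<Gamma> \<sigma> w)"

definition effective_cost ::
    "('v, 'm) terminal_game_scheme \<Rightarrow> nat \<Rightarrow> (nat \<Rightarrow> 'v \<Rightarrow> 'v) \<Rightarrow> real" where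
  "effective_cost \<Gamma> i \<sigma> =
     (if terminal_play \<Gamma> \<sigma> then local_cost \<Gamma> i (THE w. terminates_at \<Gamma> \<sigma> w) else 0)"

definition nash_equilibrium ::
    "('v, 'm) terminal_game_scheme \<Rightarrow> (nat \<Rightarrow> 'v \<Rightarrow> 'v) \<Rightarrow> bool" where
  "nash_equilibrium \<Gamma> \<sigma> \<longleftrightarrow> \<sigma> \<in> situations \<Gamma> \<and>
     (\<forall>i\<in>players \<Gamma>. \<forall>\<sigma>'\<in>situations \<Gamma>.
        (\<forall>j\<in>players \<Gamma> - {i}. \<sigma>' j = \<sigma> j) \<longrightarrow> effective_cost \<Gamma> i \<sigma> \<le> effective_cost \<Gamma> i \<sigma>')"

definition terminal_nash_equilibrium ::
    "('v, 'm) terminal_game_scheme \<Rightarrow> (nat \<Rightarrow> 'v \<Rightarrow> 'v) \<Rightarrow> bool" where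
  "terminal_nash_equilibrium \<Gamma> \<sigma> \<longleftrightarrow> nash_equilibrium \<Gamma> \<sigma> \<and> terminal_play \<Gamma> \<sigma>"

definition edge_symmetric :: "('v, 'm) terminal_game_scheme \<Rightarrow> bool" where
  "edge_symmetric \<Gamma> \<longleftrightarrow>
     (\<forall>u v. (v, u) \<in> moves \<Gamma> \<longrightarrow> u \<notin> terminals \<Gamma> \<longrightarrow> (u, v) \<in> moves \<Gamma>)"

text \<open>Costs are minimized and infinite plays cost 0, so negative costs are preferred to them.\<close>

definition infinite_plays_worst :: "('v, 'm) terminal_game_scheme \<Rightarrow> bool" where
  "infinite_plays_worst \<Gamma> \<longleftrightarrow> (\<forall>i\<in>players \<Gamma>. \<forall>w\<in>terminals \<Gamma>. local_cost \<Gamma> i w < 0)"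

text \<open>The two definite descriptions above are well defined.\<close>

lemma (in terminal_game) controller_unique:
  assumes "v \<in> positions \<Gamma> - terminals \<Gamma>"
  shows "\<exists>!i. i \<in> players \<Gamma> \<and> v \<in> controlled \<Gamma> i"
  using assms positions_eq controlled_disjoint by (fastforce simp: disjoint_family_on_def)

lemma play_stops:
  assumes "play \<Gamma> \<sigma> k = Some w" "w \<in> terminals \<Gamma>" "k < m"
  shows "play \<Gamma> \<sigma> m = None"
  using assms(3,1,2) by (induction m) (auto simp: less_Suc_eq)

lemma terminates_at_unique:
  assumes "terminates_at \<Gamma> \<sigma> w" "terminates_at \<Gamma> \<sigma> w'"
  shows "w = w'"
proof -
  obtain k m where km: "play \<Gamma> \<sigma> k = Some w" "play \<Gamma> \<sigma> m = Some w'"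
    and "w \<in> terminals \<Gamma>" "w' \<in> terminals \<Gamma>"
    using assms by (auto simp: terminates_at_def)
  then have "\<not> k < m" "\<not> m < k"
    by (auto dest: play_stops)
  with km show ?thesis by (simp add: linorder_neq_iff)
qed

end

theory Submission
  imports Defs
begin

text \<open>
  By edge symmetry a player can travel freely inside a connected block of positions that she
  controls. Walk from the initial position towards a terminal, stop at the first block that is
  adjacent to a terminal, and let \<open>P\<close> be the union of the blocks met so far. The last block
  moves to the terminal \<open>w\<close> that is best for its owner among those adjacent to it, the other
  positions of \<open>P\<close> move towards \<open>w\<close> inside \<open>P\<close>, and the positions outside \<open>P\<close> that are adjacent
  to \<open>P\<close> move back into \<open>P\<close>. A deviating player who leaves \<open>P\<close> leaves one of her own blocks, hence
  arrives at a position of an opponent and is sent back, so she can only reach \<open>w\<close> or, if she owns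
  the last block, a terminal adjacent to that block.
\<close>

text \<open>The \<open>LEAST\<close> terms are lengths of shortest paths to \<open>t\<close>, and
  the first arc of a shortest path lowers this length. This later yields the rank that forces the
  play to terminate.\<close>

lemma decreasing_successor:
  assumes "(p, t) \<in> R\<^sup>*" "p \<noteq> t"
  obtains q where "(p, q) \<in> R" "(q, t) \<in> R\<^sup>*"
    "(LEAST n. (q, t) \<in> R ^^ n) < (LEAST n. (p, t) \<in> R ^^ n)"
proof -
  define n where "n = (LEAST n. (p, t) \<in> R ^^ n)"
  have "(p, t) \<in> R ^^ n" unfolding n_def using assms(1) rtrancl_imp_relpow by (metis LeastI)
  moreover from this have "n \<noteq> 0" using assms(2) by (metis relpow_0_E)
  ultimately obtain m q where "n = Suc m" "(p, q) \<in> R" "(q, t) \<in> R ^^ m"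
    by (metis not0_implies_Suc relpow_Suc_E2)
  moreover from this have "(LEAST n. (q, t) \<in> R ^^ n) < n"
    by (simp add: Least_le le_imp_less_Suc)
  ultimately show ?thesis using that relpow_imp_rtrancl n_def by metis
qed

section \<open>Moves, controllers and plays\<close>

context terminal_game
begin

abbreviation "inner \<equiv> positions \<Gamma> - terminals \<Gamma>"

lemma move_positions:
  assumes "(u, v) \<in> moves \<Gamma>"
  shows "u \<in> inner" "v \<in> positions \<Gamma>"
proof -
  interpret pair_fin_digraph "digraph_of \<Gamma>" by (rule finite_digraph)
  show "v \<in> positions \<Gamma>" using assms in_arcsD2 by blast
  moreover have "u \<in> positions \<Gamma>" using assms in_arcsD1 by blast
  ultimately show "u \<in> inner" using assms terminals_iff by blast
qed

lemma finite_positions: "finite (positions \<Gamma>)"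
  using finite_digraph by (simp add: pair_fin_digraph_def pair_fin_digraph_axioms_def)

lemma controller_props:
  assumes "v \<in> inner"
  shows "controller \<Gamma> v \<in> players \<Gamma>" "v \<in> controlled \<Gamma> (controller \<Gamma> v)"
  using theI'[OF controller_unique[OF assms]] by (auto simp: controller_def)

lemma controller_eqI:
  assumes "i \<in> players \<Gamma>" "v \<in> controlled \<Gamma> i"
  shows "controller \<Gamma> v = i" "v \<in> inner"
proof -
  show *: "v \<in> inner" using assms positions_eq controlled_nonterminal by blast
  show "controller \<Gamma> v = i"
    using controller_unique[OF *] controller_props[OF *] assms by blast
qed

lemma situation_move:
  assumes "\<sigma> \<in> situations \<Gamma>" "v \<in> inner"
  shows "(v, \<sigma> (controller \<Gamma> v) v) \<in> moves \<Gamma>"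
proof -
  have "\<sigma> (controller \<Gamma> v) \<in> strategies \<Gamma> (controller \<Gamma> v)"
    using assms(1) controller_props(1)[OF assms(2)] by (auto simp: situations_def)
  then show ?thesis using controller_props(2)[OF assms(2)] by (auto simp: strategies_def)
qed

lemma play_reaches:
  assumes "\<sigma> \<in> situations \<Gamma>" "play \<Gamma> \<sigma> k = Some v"
  shows "v \<in> positions \<Gamma>" "(initial \<Gamma>, v) \<in> (moves \<Gamma>)\<^sup>*"
proof -
  have "v \<in> positions \<Gamma> \<and> (initial \<Gamma>, v) \<in> (moves \<Gamma>)\<^sup>*"
    using assms(2)
  proof (induction k arbitrary: v)
    case 0
    then show ?case using initial_nonterminal by auto
  next
    case (Suc k)
    then obtain u where u: "play \<Gamma> \<sigma> k = Some u" "u \<notin> terminals \<Gamma>"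
      "v = \<sigma> (controller \<Gamma> u) u"
      by (auto split: option.splits if_splits)
    with Suc.IH have "u \<in> inner" "(initial \<Gamma>, u) \<in> (moves \<Gamma>)\<^sup>*" by auto
    moreover from this have "(u, v) \<in> moves \<Gamma>" using situation_move assms(1) u(3) by blast
    ultimately show ?case using move_positions by (meson rtrancl.rtrancl_into_rtrancl)
  qed
  then show "v \<in> positions \<Gamma>" "(initial \<Gamma>, v) \<in> (moves \<Gamma>)\<^sup>*" by auto
qed

lemma effective_cost_terminates:
  assumes "terminates_at \<Gamma> \<sigma> w"
  shows "effective_cost \<Gamma> i \<sigma> = local_cost \<Gamma> i w"
proof -
  have "(THE w. terminates_at \<Gamma> \<sigma> w) = w"
    using assms terminates_at_unique by (intro the_equality) auto
  with assms show ?thesis by (auto simp: effective_cost_def terminal_play_def)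
qed

text \<open>Each nonterminal position has exactly one controller, so one choice function encodes a
  whole situation. The two restrictions provide the extensionality demanded by
  \<open>situations\<close> and \<open>strategies\<close>.\<close>

definition situation_of :: "('v \<Rightarrow> 'v) \<Rightarrow> nat \<Rightarrow> 'v \<Rightarrow> 'v" where
  "situation_of f = (\<lambda>i\<in>players \<Gamma>. \<lambda>v\<in>controlled \<Gamma> i. f v)"

lemma situation_of_in_situations:
  assumes "\<And>v. v \<in> inner \<Longrightarrow> (v, f v) \<in> moves \<Gamma>"
  shows "situation_of f \<in> situations \<Gamma>"
  using assms controller_eqI(2)
  by (fastforce simp: situation_of_def situations_def strategies_def)

lemma situation_of_apply:
  assumes "v \<in> inner"
  shows "situation_of f (controller \<Gamma> v) v = f v"
  using controller_props[OF assms] by (simp add: situation_of_def)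

section \<open>Exit regions and single-owner blocks\<close>

text \<open>The closure clause makes \<open>P\<close> a union of whole blocks, so a move from
  \<open>P\<close> to an inner position outside it hands control to another player. The path clause
  lets the play be steered to \<open>t\<close> without leaving \<open>P\<close>. The last clause
  leaves the choice of a terminal to the owner of \<open>t\<close> alone, who cannot improve on
  \<open>w\<close>.\<close>

definition exit_region :: "'v set \<Rightarrow> 'v \<Rightarrow> 'v \<Rightarrow> bool" where
  "exit_region P t w \<longleftrightarrow> P \<subseteq> inner \<and> t \<in> P \<and> w \<in> terminals \<Gamma> \<and> (t, w) \<in> moves \<Gamma> \<and>
     (\<forall>p\<in>P. \<forall>u\<in>inner. (p, u) \<in> moves \<Gamma> \<longrightarrow> controller \<Gamma> u = controller \<Gamma> p \<longrightarrow> u \<in> P) \<and>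
     (\<forall>p\<in>P. (p, t) \<in> (moves \<Gamma> \<inter> P \<times> P)\<^sup>*) \<and>
     (\<forall>p\<in>P. \<forall>u\<in>terminals \<Gamma>. (p, u) \<in> moves \<Gamma> \<longrightarrow> controller \<Gamma> p = controller \<Gamma> t \<and>
        local_cost \<Gamma> (controller \<Gamma> t) w \<le> local_cost \<Gamma> (controller \<Gamma> t) u)"

text \<open>Under edge symmetry this is the connected component of \<open>v\<close> among the
  positions with the same controller. Heads of arcs must be inner because \<open>controller\<close>
  is meaningless at terminals.\<close>

definition block :: "'v \<Rightarrow> 'v set" where
  "block v = {u. (v, u) \<in> {(a, b). (a, b) \<in> moves \<Gamma> \<and> b \<in> inner \<and>
     controller \<Gamma> b = controller \<Gamma> a}\<^sup>*}"

lemma block_self: "v \<in> block v"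
  by (simp add: block_def)

lemma block_props:
  assumes "v \<in> inner" "u \<in> block v"
  shows "u \<in> inner" "controller \<Gamma> u = controller \<Gamma> v"
proof -
  have "u \<in> inner \<and> controller \<Gamma> u = controller \<Gamma> v"
    using assms(2) unfolding block_def mem_Collect_eq
    by (induction rule: rtrancl_induct) (use assms(1) in auto)
  then show "u \<in> inner" "controller \<Gamma> u = controller \<Gamma> v" by auto
qed

lemma block_closed:
  assumes "p \<in> block v" "u \<in> inner" "(p, u) \<in> moves \<Gamma>" "controller \<Gamma> u = controller \<Gamma> p"
  shows "u \<in> block v"
  using assms unfolding block_def mem_Collect_eq by (auto intro: rtrancl_into_rtrancl)

text \<open>Every arc used to build the block has a nonterminal head, so edge symmetry reverses it,
  and paths from \<open>v\<close> become paths back to \<open>v\<close>.\<close>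

lemma block_connected:
  assumes "edge_symmetric \<Gamma>" "v \<in> inner" "p \<in> block v"
  shows "(v, p) \<in> (moves \<Gamma> \<inter> block v \<times> block v)\<^sup>*" "(p, v) \<in> (moves \<Gamma> \<inter> block v \<times> block v)\<^sup>*"
proof -
  let ?S = "{(a, b). (a, b) \<in> moves \<Gamma> \<and> b \<in> inner \<and> controller \<Gamma> b = controller \<Gamma> a}"
  let ?R = "moves \<Gamma> \<inter> block v \<times> block v"
  have "(v, p) \<in> ?S\<^sup>*" using assms(3) by (simp add: block_def)
  then have "(v, p) \<in> ?R\<^sup>* \<and> (p, v) \<in> ?R\<^sup>*"
  proof (induction rule: rtrancl_induct)
    case base
    show ?case by simp
  next
    case (step y z)
    have y: "y \<in> block v" using step by (simp add: block_def)
    have z: "z \<in> block v" using step by (auto simp: block_def intro: rtrancl_into_rtrancl)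
    have "y \<notin> terminals \<Gamma>" using block_props(1)[OF assms(2) y] by simp
    then have "(z, y) \<in> moves \<Gamma>"
      using assms(1) step(2) unfolding edge_symmetric_def by auto
    then have "(y, z) \<in> ?R" "(z, y) \<in> ?R" using y z step by auto
    then show ?case
      using step.IH by (meson converse_rtrancl_into_rtrancl rtrancl_into_rtrancl)
  qed
  then show "(v, p) \<in> ?R\<^sup>*" "(p, v) \<in> ?R\<^sup>*" by auto
qed

text \<open>The starting region. The block has a single owner, so it suffices to take for
  \<open>w\<close> the adjacent terminal cheapest for that owner, and for \<open>t\<close> any
  position of the block that can move to \<open>w\<close>.\<close>

lemma exit_region_block:
  assumes "edge_symmetric \<Gamma>" "v \<in> inner" "p \<in> block v" "x \<in> terminals \<Gamma>" "(p, x) \<in> moves \<Gamma>"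
  shows "\<exists>t w. exit_region (block v) t w"
proof -
  let ?X = "{x \<in> terminals \<Gamma>. \<exists>p\<in>block v. (p, x) \<in> moves \<Gamma>}"
  have "finite ?X"
    by (rule finite_subset[OF _ finite_positions]) (use positions_eq in auto)
  moreover have "?X \<noteq> {}" using assms by blast
  ultimately obtain w where w: "w \<in> ?X"
      "\<And>u. u \<in> ?X \<Longrightarrow> local_cost \<Gamma> (controller \<Gamma> v) w \<le> local_cost \<Gamma> (controller \<Gamma> v) u"
    using ex_is_arg_min_if_finite[of ?X "local_cost \<Gamma> (controller \<Gamma> v)"]
    by (auto simp: is_arg_min_linorder)
  then obtain t where t: "t \<in> block v" "(t, w) \<in> moves \<Gamma>" by blast
  \<comment> \<open>Paths between positions of the block are routed through
    \<open>v\<close>.\<close>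
  have "(q, t) \<in> (moves \<Gamma> \<inter> block v \<times> block v)\<^sup>*" if "q \<in> block v" for q
    using block_connected[OF assms(1,2)] that t(1) by (meson rtrancl_trans)
  moreover have "local_cost \<Gamma> (controller \<Gamma> v) w \<le> local_cost \<Gamma> (controller \<Gamma> v) u"
    if "q \<in> block v" "u \<in> terminals \<Gamma>" "(q, u) \<in> moves \<Gamma>" for q u
    using w(2) that by blast
  moreover have "block v \<subseteq> inner" "w \<in> terminals \<Gamma>"
    using block_props(1)[OF assms(2)] w(1) by blast+
  moreover have "\<forall>q\<in>block v. controller \<Gamma> q = controller \<Gamma> v"
    using block_props(2)[OF assms(2)] by blast
  ultimately have "exit_region (block v) t w"
    using t block_closed[of _ v] unfolding exit_region_def
    by (intro conjI ballI impI) (metis | blast)+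
  then show ?thesis by blast
qed

text \<open>The added block has no terminal neighbour, so the clause on exits is inherited from
  \<open>P\<close>. Its positions reach \<open>t\<close> by going to \<open>v\<close>, crossing to
  \<open>u\<close> and continuing inside \<open>P\<close>.\<close>

lemma exit_region_extend:
  assumes "edge_symmetric \<Gamma>" "v \<in> inner" "exit_region P t w" "u \<in> P" "(v, u) \<in> moves \<Gamma>"
    and no_exit: "\<And>p x. p \<in> block v \<Longrightarrow> x \<in> terminals \<Gamma> \<Longrightarrow> (p, x) \<notin> moves \<Gamma>"
  shows "exit_region (P \<union> block v) t w"
proof -
  let ?Q = "P \<union> block v"
  let ?R = "moves \<Gamma> \<inter> ?Q \<times> ?Q"
  have P: "(p, t) \<in> ?R\<^sup>*" if "p \<in> P" for p
  proof -
    have "(p, t) \<in> (moves \<Gamma> \<inter> P \<times> P)\<^sup>*" using assms(3) that unfolding exit_region_def by blast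
    moreover have "moves \<Gamma> \<inter> P \<times> P \<subseteq> ?R" by blast
    ultimately show ?thesis using rtrancl_mono by blast
  qed
  have "(p, t) \<in> ?R\<^sup>*" if "p \<in> block v" for p
  proof -
    have "moves \<Gamma> \<inter> block v \<times> block v \<subseteq> ?R" by blast
    with block_connected(2)[OF assms(1,2) that] have "(p, v) \<in> ?R\<^sup>*" using rtrancl_mono by blast
    moreover have "(v, u) \<in> ?R" using assms(4,5) block_self by blast
    ultimately show ?thesis using P[OF assms(4)] by (meson rtrancl_into_rtrancl rtrancl_trans)
  qed
  with P have "\<forall>p\<in>?Q. (p, t) \<in> ?R\<^sup>*" by blast
  then show ?thesis
    using assms(3) block_props(1)[OF assms(2)] block_closed no_exit
    unfolding exit_region_def by blast
qed

text \<open>Induction backwards along the path to \<open>x\<close>: a block that touches a terminal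
  starts a fresh region, discarding the rest of the path; any other block is attached to the region
  of the next position.\<close>

lemma exit_region_exists:
  assumes "edge_symmetric \<Gamma>" "(v, x) \<in> (moves \<Gamma>)\<^sup>*" "x \<in> terminals \<Gamma>" "v \<notin> terminals \<Gamma>"
  shows "\<exists>P t w. v \<in> P \<and> exit_region P t w"
  using assms(2,4)
proof (induction rule: converse_rtrancl_induct)
  case base
  then show ?case using assms(3) by simp
next
  case (step v u)
  have v: "v \<in> inner" using move_positions(1)[OF step(1)] .
  show ?case
  proof (cases "\<exists>p\<in>block v. \<exists>x\<in>terminals \<Gamma>. (p, x) \<in> moves \<Gamma>")
    case True
    then obtain p x where "p \<in> block v" "x \<in> terminals \<Gamma>" "(p, x) \<in> moves \<Gamma>" by blast
    from exit_region_block[OF assms(1) v this] show ?thesis using block_self by blast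
  next
    case False
    then have "u \<notin> terminals \<Gamma>" using step(1) block_self by blast
    then obtain P t w where "u \<in> P" "exit_region P t w" using step.IH by blast
    then have "exit_region (P \<union> block v) t w"
      using exit_region_extend[OF assms(1) v] step(1) False by blast
    then show ?thesis using block_self by blast
  qed
qed

section \<open>Strategies induced by an exit region, and deviations from them\<close>

lemma exit_region_strategy:
  assumes "exit_region P t w"
  obtains f :: "'v \<Rightarrow> 'v" and rank :: "'v \<Rightarrow> nat" where
    "\<And>v. v \<in> inner \<Longrightarrow> (v, f v) \<in> moves \<Gamma>"
    "f t = w"
    "\<And>p. p \<in> P \<Longrightarrow> p \<noteq> t \<Longrightarrow> f p \<in> P \<and> rank (f p) < rank p"
    "\<And>v u. v \<in> inner \<Longrightarrow> v \<notin> P \<Longrightarrow> (v, u) \<in> moves \<Gamma> \<Longrightarrow> u \<in> P \<Longrightarrow> f v \<in> P"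
proof -
  let ?R = "moves \<Gamma> \<inter> P \<times> P"
  \<comment> \<open>The distance to \<open>t\<close> along moves that stay in
    \<open>P\<close>.\<close>
  define rank where "rank p = (LEAST n. (p, t) \<in> ?R ^^ n)" for p
  have "\<exists>q. (v, q) \<in> moves \<Gamma> \<and> (v = t \<longrightarrow> q = w) \<and>
      (v \<in> P \<longrightarrow> v \<noteq> t \<longrightarrow> q \<in> P \<and> rank q < rank v) \<and>
      (v \<notin> P \<longrightarrow> (\<exists>u\<in>P. (v, u) \<in> moves \<Gamma>) \<longrightarrow> q \<in> P)" if "v \<in> inner" for v
  proof (cases "v \<in> P \<and> v \<noteq> t")
    case True
    then have "(v, t) \<in> ?R\<^sup>*" using assms by (simp add: exit_region_def)
    then obtain q where "(v, q) \<in> ?R" "rank q < rank v"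
      using True decreasing_successor unfolding rank_def by metis
    then show ?thesis using True by blast
  next
    case False
    \<comment> \<open>This arbitrary move serves positions outside \<open>P\<close> without a
      neighbour in \<open>P\<close>; \<open>t\<close> takes \<open>w\<close>, and the other outside
      positions take a neighbour in \<open>P\<close>.\<close>
    have "\<exists>q. (v, q) \<in> moves \<Gamma>" using that terminals_iff by blast
    then show ?thesis using False assms unfolding exit_region_def by blast
  qed
  then obtain f where f: "\<And>v. v \<in> inner \<Longrightarrow> (v, f v) \<in> moves \<Gamma> \<and> (v = t \<longrightarrow> f v = w) \<and>
      (v \<in> P \<longrightarrow> v \<noteq> t \<longrightarrow> f v \<in> P \<and> rank (f v) < rank v) \<and>
      (v \<notin> P \<longrightarrow> (\<exists>u\<in>P. (v, u) \<in> moves \<Gamma>) \<longrightarrow> f v \<in> P)"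
    by metis
  have "P \<subseteq> inner" "t \<in> P" using assms by (auto simp: exit_region_def)
  with f show ?thesis by (intro that[of f rank]) blast+
qed

text \<open>The rank drops at each move within \<open>P\<close> until \<open>t\<close> is reached,
  whose move ends the play at \<open>w\<close>.\<close>

lemma exit_region_terminates:
  assumes "exit_region P t w" "initial \<Gamma> \<in> P" "f t = w"
    and desc: "\<And>p. p \<in> P \<Longrightarrow> p \<noteq> t \<Longrightarrow> f p \<in> P \<and> rank (f p) < (rank p :: nat)"
  shows "terminates_at \<Gamma> (situation_of f) w"
proof -
  have w: "w \<in> terminals \<Gamma>" and P: "P \<subseteq> inner" using assms(1) by (auto simp: exit_region_def)
  have "\<exists>m. play \<Gamma> (situation_of f) m = Some w"
    if "play \<Gamma> (situation_of f) k = Some p" "p \<in> P" for k p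
    using that
  proof (induction "rank p" arbitrary: k p rule: less_induct)
    case less
    have p: "p \<in> inner" using less.prems(2) P by blast
    then have step: "play \<Gamma> (situation_of f) (Suc k) = Some (f p)"
      using less.prems(1) situation_of_apply[OF p] by simp
    show ?case
    proof (cases "p = t")
      case True
      then show ?thesis using step assms(3) by blast
    next
      case False
      then show ?thesis using less.hyps[OF _ step] desc less.prems(2) by blast
    qed
  qed
  from this[of 0] show ?thesis using assms(2) w by (auto simp: terminates_at_def)
qed

text \<open>The deviating play can end only at \<open>w\<close>, reached by an opponent who follows
  \<open>f\<close>, or through an exit owned by \<open>i\<close>; at such an exit the last clause of
  \<open>exit_region\<close> makes \<open>w\<close> optimal for \<open>i\<close>.\<close>

lemma exit_region_deviation:
  assumes "exit_region P t w" "initial \<Gamma> \<in> P" "f t = w"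
    and inside: "\<And>p. p \<in> P \<Longrightarrow> p \<noteq> t \<Longrightarrow> f p \<in> P"
    and return: "\<And>v u. v \<in> inner \<Longrightarrow> v \<notin> P \<Longrightarrow> (v, u) \<in> moves \<Gamma> \<Longrightarrow> u \<in> P \<Longrightarrow> f v \<in> P"
    and sym: "edge_symmetric \<Gamma>"
    and dev: "\<sigma> \<in> situations \<Gamma>" "\<And>j. j \<in> players \<Gamma> - {i} \<Longrightarrow> \<sigma> j = situation_of f j"
    and stop: "terminates_at \<Gamma> \<sigma> x"
  shows "local_cost \<Gamma> i w \<le> local_cost \<Gamma> i x"
proof -
  have w: "w \<in> terminals \<Gamma>" and P: "P \<subseteq> inner"
    using assms(1) by (simp_all add: exit_region_def)
  have closed: "p \<in> P \<Longrightarrow> u \<in> inner \<Longrightarrow> (p, u) \<in> moves \<Gamma> \<Longrightarrow>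
      controller \<Gamma> u = controller \<Gamma> p \<Longrightarrow> u \<in> P" for p u
    using assms(1) unfolding exit_region_def by blast
  have exits: "local_cost \<Gamma> (controller \<Gamma> p) w \<le> local_cost \<Gamma> (controller \<Gamma> p) u"
    if "p \<in> P" "u \<in> terminals \<Gamma>" "(p, u) \<in> moves \<Gamma>" for p u
    using assms(1) that by (simp add: exit_region_def)
  have follow: "\<sigma> (controller \<Gamma> v) v = f v" if "v \<in> inner" "controller \<Gamma> v \<noteq> i" for v
    using that dev(2) situation_of_apply[OF that(1)] controller_props(1)[OF that(1)] by auto
  \<comment> \<open>Invariant of the deviating play. The middle alternative records what forces the
    return: an opponent still follows \<open>f\<close>, and a neighbour in \<open>P\<close> makes
    \<open>f\<close> lead back.\<close>
  have "v \<in> P \<or> (v \<in> inner \<and> v \<notin> P \<and> controller \<Gamma> v \<noteq> i \<and> (\<exists>u\<in>P. (v, u) \<in> moves \<Gamma>)) \<or>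
      (v \<in> terminals \<Gamma> \<and> local_cost \<Gamma> i w \<le> local_cost \<Gamma> i v)"
    if "play \<Gamma> \<sigma> k = Some v" for k v
    using that
  proof (induction k arbitrary: v)
    case 0
    then show ?case using assms(2) by auto
  next
    case (Suc k)
    then obtain p where p: "play \<Gamma> \<sigma> k = Some p" "p \<notin> terminals \<Gamma>"
      "v = \<sigma> (controller \<Gamma> p) p"
      by (auto split: option.splits if_splits)
    have p_in: "p \<in> inner" using p play_reaches(1)[OF dev(1)] by blast
    have pv: "(p, v) \<in> moves \<Gamma>" using situation_move[OF dev(1) p_in] p(3) by simp
    have v: "v \<in> positions \<Gamma>" using move_positions(2)[OF pv] .
    consider "p \<in> P" "controller \<Gamma> p = i" | "p \<in> P" "controller \<Gamma> p \<noteq> i"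
      | "p \<notin> P" "controller \<Gamma> p \<noteq> i" "\<exists>u\<in>P. (p, u) \<in> moves \<Gamma>"
      using Suc.IH[OF p(1)] p(2) by blast
    then show ?case
    proof cases
      case 1
      show ?thesis
      proof (cases "v \<in> terminals \<Gamma>")
        case True
        then show ?thesis using exits[OF 1(1) True pv] 1(2) by simp
      next
        case False
        \<comment> \<open>The reversed arc makes \<open>v\<close> adjacent to \<open>P\<close>. If
          \<open>v\<close> lies outside \<open>P\<close>, closure shows that it is not owned by
          \<open>i\<close>, so the middle alternative holds.\<close>
        moreover from this have "(v, p) \<in> moves \<Gamma>"
          using sym pv p(2) unfolding edge_symmetric_def by blast
        ultimately show ?thesis using closed[OF 1(1) _ pv] 1 v by auto
      qed
    next
      case 2
      then show ?thesis using follow[OF p_in] p(3) inside w assms(3) by (cases "p = t") auto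
    next
      case 3
      then show ?thesis using follow[OF p_in] p(3) return[OF p_in] by auto
    qed
  qed
  \<comment> \<open>A terminal is not inner, so at \<open>x\<close> only the last alternative
    remains.\<close>
  with stop P show ?thesis unfolding terminates_at_def by blast
qed

section \<open>Existence of equilibria\<close>

lemma terminal_nash_equilibrium_exists:
  assumes "edge_symmetric \<Gamma>" "infinite_plays_worst \<Gamma>"
    and "(initial \<Gamma>, x) \<in> (moves \<Gamma>)\<^sup>*" "x \<in> terminals \<Gamma>"
  shows "\<exists>\<sigma>. terminal_nash_equilibrium \<Gamma> \<sigma>"
proof -
  obtain P t w where P: "initial \<Gamma> \<in> P" "exit_region P t w"
    using exit_region_exists[OF assms(1,3,4)] initial_nonterminal by blast
  obtain f and rank :: "'v \<Rightarrow> nat" where f: "\<And>v. v \<in> inner \<Longrightarrow> (v, f v) \<in> moves \<Gamma>" "f t = w"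
    "\<And>p. p \<in> P \<Longrightarrow> p \<noteq> t \<Longrightarrow> f p \<in> P \<and> rank (f p) < rank p"
    "\<And>v u. v \<in> inner \<Longrightarrow> v \<notin> P \<Longrightarrow> (v, u) \<in> moves \<Gamma> \<Longrightarrow> u \<in> P \<Longrightarrow> f v \<in> P"
    using exit_region_strategy[OF P(2)] by blast
  let ?\<sigma> = "situation_of f"
  have stop: "terminates_at \<Gamma> ?\<sigma> w"
    using exit_region_terminates[where rank = rank, OF P(2,1) f(2,3)] by blast
  have "effective_cost \<Gamma> i ?\<sigma> \<le> effective_cost \<Gamma> i \<sigma>'"
    if i: "i \<in> players \<Gamma>" and dev: "\<sigma>' \<in> situations \<Gamma>" "\<forall>j\<in>players \<Gamma> - {i}. \<sigma>' j = ?\<sigma> j" for i \<sigma>'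
  proof (cases "terminal_play \<Gamma> \<sigma>'")
    case True
    then obtain y where y: "terminates_at \<Gamma> \<sigma>' y" by (auto simp: terminal_play_def)
    have "local_cost \<Gamma> i w \<le> local_cost \<Gamma> i y"
      by (rule exit_region_deviation[where f = f and \<sigma> = \<sigma>', OF P(2,1) f(2)])
        (use f(3,4) assms(1) dev y in blast)+
    then show ?thesis using effective_cost_terminates stop y by simp
  next
    case False
    \<comment> \<open>A deviation to an infinite play raises the cost from a negative value to
      0.\<close>
    have "local_cost \<Gamma> i w < 0"
      using assms(2) i stop by (auto simp: infinite_plays_worst_def terminates_at_def)
    moreover have "effective_cost \<Gamma> i \<sigma>' = 0" using False by (simp add: effective_cost_def)
    ultimately show ?thesis using effective_cost_terminates[OF stop] by simp
  qed
  then have "terminal_nash_equilibrium \<Gamma> ?\<sigma>"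
    using situation_of_in_situations[OF f(1)] stop
    unfolding terminal_nash_equilibrium_def nash_equilibrium_def terminal_play_def by blast
  then show ?thesis by blast
qed

text \<open>Every play is infinite, so all situations cost every player 0 and any one of them is an
  equilibrium.\<close>

lemma nash_equilibrium_if_unreachable:
  assumes "\<And>w. w \<in> terminals \<Gamma> \<Longrightarrow> (initial \<Gamma>, w) \<notin> (moves \<Gamma>)\<^sup>*"
  shows "\<exists>\<sigma>. nash_equilibrium \<Gamma> \<sigma>"
proof -
  have "\<forall>v\<in>inner. \<exists>u. (v, u) \<in> moves \<Gamma>" using terminals_iff by blast
  then obtain f where "\<And>v. v \<in> inner \<Longrightarrow> (v, f v) \<in> moves \<Gamma>" by metis
  then have "situation_of f \<in> situations \<Gamma>" by (rule situation_of_in_situations)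
  moreover have "effective_cost \<Gamma> i \<sigma> = 0" if "\<sigma> \<in> situations \<Gamma>" for i \<sigma>
    using assms play_reaches(2)[OF that]
    by (auto simp: effective_cost_def terminal_play_def terminates_at_def)
  ultimately have "nash_equilibrium \<Gamma> (situation_of f)" by (simp add: nash_equilibrium_def)
  then show ?thesis by blast
qed

end

theorem corollary5:
  fixes \<Gamma> :: "'v terminal_game"
  assumes "terminal_game \<Gamma>"
    and "edge_symmetric \<Gamma>"
    and "infinite_plays_worst \<Gamma>"
  shows "(\<exists>\<sigma>. nash_equilibrium \<Gamma> \<sigma>) \<and>
    ((\<exists>w\<in>terminals \<Gamma>. reachable (with_proj (digraph_of \<Gamma>)) (initial \<Gamma>) w) \<longrightarrow>
      (\<exists>\<sigma>. terminal_nash_equilibrium \<Gamma> \<sigma>))"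
proof -
  interpret terminal_game \<Gamma> by (rule assms(1))
  \<comment> \<open>The first claim splits on whether a terminal is reachable;
    \<open>reachable\<close> is translated into the reflexive transitive closure of the
    moves.\<close>
  show ?thesis
    using terminal_nash_equilibrium_exists[OF assms(2,3)] nash_equilibrium_if_unreachable
      reachable_rtranclI[of "with_proj (digraph_of \<Gamma>)"]
    unfolding terminal_nash_equilibrium_def by fastforce
qed

end
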